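(* Let $n\ge1$, let $N$ and $V$ be finite disjoint sets with $|N|=|V|=n$, and let $z=(z_{ij}^t)_{i\in N,\,j\in V,\,t\in[n]}$ be a vector of nonnegative real numbers satisfying $$\sum_{\tau=t+1}^n\sum_{k\in N}z_{kj}^{\tau}+n\,z_{ij}^t\le 1\qquad\text{for all } i\in N,\ j\in V,\ t\in[n].$$ Set $z_{ij}:=\sum_{t\in[n]}z_{ij}^t$ for $i\in N$, $j\in V$. Then the right-star inequalities hold: $$\sum_{i\in I}z_{ij}\le 1-\left(1-\frac{|I|}{n}\right)^n\qquad\text{for all } j\in V,\ I\subseteq N.$$
   Context: $[n]=\{1,\dots,n\}$. For $t=n$ the sum over $\tau$ from $t+1$ to $n$ is empty. *)

theory Defs
  imports Complex_Main
begin

end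

theory Submission
  imports Defs
begin

text \<open>
  For fixed \<open>j\<close> and \<open>I\<close>, averaging the hypothesis at time \<open>t\<close> over \<open>i \<in> I\<close> and dropping the terms
  with \<open>k \<notin> I\<close> gives \<open>a\<^sub>t \<le> (|I|/n) (1 - \<Sum>\<^sub>\<tau>\<^sub>>\<^sub>t a\<^sub>\<tau>)\<close>, where \<open>a\<^sub>t\<close> is the sum of the \<open>z i j t\<close> over \<open>i \<in> I\<close>.
  So each step from \<open>t + 1\<close> down to \<open>t\<close> multiplies the remainder \<open>1 - \<Sum>\<^sub>\<tau>\<^sub>\<ge>\<^sub>t a\<^sub>\<tau>\<close> by at
  least \<open>1 - |I|/n\<close>.
\<close>

lemma sum_le_of_backward_recurrence:
  fixes a :: "nat \<Rightarrow> real"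
  assumes "p \<le> 1"
    and step: "\<And>t. t \<in> {1..n} \<Longrightarrow> a t \<le> p * (1 - (\<Sum>\<tau>=t+1..n. a \<tau>))"
  shows "(\<Sum>t=1..n. a t) \<le> 1 - (1 - p) ^ n"
proof -
  \<comment> \<open>Induction from the top index down: \<open>d\<close> counts the last indices
    already summed, so \<open>d = 0\<close> is the empty sum and \<open>d = n\<close> the
    claim.\<close>
  have "(1 - p) ^ d \<le> 1 - (\<Sum>t=n-d+1..n. a t)" if "d \<le> n" for d
    using that
  proof (induction d)
    case 0
    then show ?case by simp
  next
    case (Suc d)
    define S where "S = (\<Sum>t=n-d+1..n. a t)"
    have shift: "n - Suc d + 1 = n - d"
      using Suc.prems by simp
    have "(1 - p) ^ Suc d \<le> (1 - p) * (1 - S)"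
      using Suc \<open>p \<le> 1\<close> by (simp add: S_def mult_left_mono)
    \<comment> \<open>Rearranged \<open>step\<close> at \<open>n - d\<close>, which is at least 1
      since \<open>Suc d \<le> n\<close>.\<close>
    also have "\<dots> \<le> 1 - (a (n - d) + S)"
      using step[of "n - d"] Suc.prems by (simp add: S_def algebra_simps)
    also have "a (n - d) + S = (\<Sum>t=n-Suc d+1..n. a t)"
      unfolding shift S_def by (simp add: sum.atLeast_Suc_atMost)
    finally show ?case .
  qed
  from this[of n] show ?thesis by simp
qed

theorem theorem4:
  fixes n :: nat
    and N V :: "'a set"
    and z :: "'a \<Rightarrow> 'a \<Rightarrow> nat \<Rightarrow> real"
  assumes "n \<ge> 1"
    and "finite N" and "finite V" and "N \<inter> V = {}"
    and "card N = n" and "card V = n"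
    and "\<And>i j t. i \<in> N \<Longrightarrow> j \<in> V \<Longrightarrow> t \<in> {1..n} \<Longrightarrow> z i j t \<ge> 0"
    and "\<And>i j t. i \<in> N \<Longrightarrow> j \<in> V \<Longrightarrow> t \<in> {1..n} \<Longrightarrow>
           (\<Sum>\<tau>=t+1..n. \<Sum>k\<in>N. z k j \<tau>) + real n * z i j t \<le> 1"
  shows "\<forall>j\<in>V. \<forall>I. I \<subseteq> N \<longrightarrow>
           (\<Sum>i\<in>I. \<Sum>t\<in>{1..n}. z i j t) \<le> 1 - (1 - real (card I) / real n) ^ n"
proof (intro ballI allI impI)
  fix j I assume j: "j \<in> V" and I: "I \<subseteq> N"
  define p where "p = real (card I) / real n"
  define a where "a t = (\<Sum>i\<in>I. z i j t)" for t
  have "card I \<le> n"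
    using card_mono[OF \<open>finite N\<close> I] \<open>card N = n\<close> by simp
  then have p: "p \<le> 1"
    using \<open>n \<ge> 1\<close> by (simp add: p_def)
  have step: "a t \<le> p * (1 - (\<Sum>\<tau>=t+1..n. a \<tau>))" if t: "t \<in> {1..n}" for t
  proof -
    have "(\<Sum>\<tau>=t+1..n. a \<tau>) \<le> (\<Sum>\<tau>=t+1..n. \<Sum>k\<in>N. z k j \<tau>)"
      unfolding a_def using assms(7) j I \<open>finite N\<close> by (intro sum_mono sum_mono2) auto
    then have "real n * z i j t \<le> 1 - (\<Sum>\<tau>=t+1..n. a \<tau>)" if "i \<in> I" for i
      using assms(8)[of i j t] that I j t by auto
    \<comment> \<open>The bound is the same for every \<open>i\<close>, so summing over
      \<open>I\<close> yields the factor \<open>card I\<close>; division by \<open>n\<close> then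
      produces \<open>p\<close>.\<close>
    then have "(\<Sum>i\<in>I. real n * z i j t) \<le> real (card I) * (1 - (\<Sum>\<tau>=t+1..n. a \<tau>))"
      by (rule sum_bounded_above)
    then show ?thesis
      using \<open>n \<ge> 1\<close> by (simp add: p_def a_def sum_distrib_left[symmetric] field_simps)
  qed
  have "(\<Sum>i\<in>I. \<Sum>t\<in>{1..n}. z i j t) = (\<Sum>t=1..n. a t)"
    unfolding a_def by (rule sum.swap)
  also have "\<dots> \<le> 1 - (1 - p) ^ n"
    using p step by (rule sum_le_of_backward_recurrence)
  finally show "(\<Sum>i\<in>I. \<Sum>t\<in>{1..n}. z i j t) \<le> 1 - (1 - real (card I) / real n) ^ n"
    by (simp add: p_def)
qed

end
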